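(* Let $n,d\geq 1$ and let $f$ be an $n$-bit partial monotone Boolean function. Let $P$ be a protocol of degree $d$ with inequality solving $f$, and let $s$ be the size of $P$. Then there exists a protocol of degree $2$ with equality solving $f$ whose size is $\mathcal{O}(sn^{d+2})$.
   Context: A partial monotone Boolean function $f$ in $n$ variables is given by disjoint sets $f^{-1}(0), f^{-1}(1)\subseteq\{0,1\}^n$ such that whenever $x\in f^{-1}(0)$, $y\in f^{-1}(1)$ there is an index $i$ with $x_i=0$, $y_i=1$. A protocol of degree $d$ with feasibility relation (on $n$ bits) is a directed acyclic graph $G=(V,E)$ together with a relation $F\subseteq\{0,1\}^n\times\{0,1\}^n\times V$ such that (i) $G$ has exactly one source $v_0$ (in-degree zero) and every vertex has out-degree at most $d$; (ii) for every sink $\ell$ (out-degree zero) there is an index $i$ such that for all $x,y\in\{0,1\}^n$, $(x,y,\ell)\in F$ iff $x_i=0$ and $y_i=1$. The protocol solves $f$ if for every $x\in f^{-1}(0)$ and $y\in f^{-1}(1)$: (a) $(x,y,v_0)\in F$; (b) for every vertex $v$ with $p\ge1$ children $u_1,\dots,u_p$, if $(x,y,v)\in F$ then $(x,y,u_i)\in F$ for some $i$. The size of a protocol is its number of vertices. A protocol of degree $d$ with inequality is such a protocol where for each vertex $v$ there are functions $q_v,r_v\colon\{0,1\}^n\to\mathbb{R}$ with $(x,y,v)\in F$ iff $q_v(x)<r_v(y)$ for all $x,y$. A protocol of degree $d$ with equality is one where for each vertex $v$ there are functions $q_v,r_v\colon\{0,1\}^n\to\mathbb{R}$ with $(x,y,v)\in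 F$ iff $q_v(x)=r_v(y)$ for all $x,y$. The $\mathcal{O}$-notation with several parameters means: $g\in\mathcal{O}(h)$ iff there is $c>0$ such that for all values of the parameters $g\le c\,h+c$. *)

theory Defs
  imports Complex_Main
begin

text \<open>Bit vectors of length \<open>n\<close> are Boolean lists (\<open>True\<close> is 1, \<open>False\<close> is 0), with indices
  running over \<open>0, \<dots>, n - 1\<close>.\<close>

definition cube :: "nat \<Rightarrow> bool list set" where
  "cube n = {x. length x = n}"

record partial_fun =
  zeros :: "bool list set"
  ones :: "bool list set"

definition partial_monotone :: "nat \<Rightarrow> partial_fun \<Rightarrow> bool" where
  "partial_monotone n f \<longleftrightarrow>
     zeros f \<subseteq> cube n \<and> ones f \<subseteq> cube n \<and> zeros f \<inter> ones f = {} \<and>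
     (\<forall>x\<in>zeros f. \<forall>y\<in>ones f. \<exists>i<n. \<not> x ! i \<and> y ! i)"

record 'v protocol =
  verts :: "'v set"
  edges :: "('v \<times> 'v) set"
  feas :: "(bool list \<times> bool list \<times> 'v) set"

definition children :: "'v protocol \<Rightarrow> 'v \<Rightarrow> 'v set" where
  "children P v = edges P `` {v}"

definition is_source :: "'v protocol \<Rightarrow> 'v \<Rightarrow> bool" where
  "is_source P v \<longleftrightarrow> v \<in> verts P \<and> (\<forall>u. (u, v) \<notin> edges P)"

definition is_sink :: "'v protocol \<Rightarrow> 'v \<Rightarrow> bool" where
  "is_sink P v \<longleftrightarrow> v \<in> verts P \<and> children P v = {}"

definition source :: "'v protocol \<Rightarrow> 'v" where
  "source P = (THE v. is_source P v)"

definition protocol_size :: "'v protocol \<Rightarrow> nat" where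
  "protocol_size P = card (verts P)"

definition feasibility_protocol :: "nat \<Rightarrow> nat \<Rightarrow> 'v protocol \<Rightarrow> bool" where
  "feasibility_protocol n d P \<longleftrightarrow>
     finite (verts P) \<and> edges P \<subseteq> verts P \<times> verts P \<and> acyclic (edges P) \<and>
     feas P \<subseteq> cube n \<times> cube n \<times> verts P \<and>
     (\<exists>!v. is_source P v) \<and>
     (\<forall>v\<in>verts P. card (children P v) \<le> d) \<and>
     (\<forall>l. is_sink P l \<longrightarrow>
        (\<exists>i<n. \<forall>x\<in>cube n. \<forall>y\<in>cube n. (x, y, l) \<in> feas P \<longleftrightarrow> \<not> x ! i \<and> y ! i))"

definition solves :: "'v protocol \<Rightarrow> partial_fun \<Rightarrow> bool" where
  "solves P f \<longleftrightarrow>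
     (\<forall>x\<in>zeros f. \<forall>y\<in>ones f.
        (x, y, source P) \<in> feas P \<and>
        (\<forall>v\<in>verts P. children P v \<noteq> {} \<longrightarrow> (x, y, v) \<in> feas P \<longrightarrow>
           (\<exists>u\<in>children P v. (x, y, u) \<in> feas P)))"

definition inequality_protocol :: "nat \<Rightarrow> nat \<Rightarrow> 'v protocol \<Rightarrow> bool" where
  "inequality_protocol n d P \<longleftrightarrow>
     feasibility_protocol n d P \<and>
     (\<forall>v\<in>verts P. \<exists>q r :: bool list \<Rightarrow> real.
        \<forall>x\<in>cube n. \<forall>y\<in>cube n. (x, y, v) \<in> feas P \<longleftrightarrow> q x < r y)"

definition equality_protocol :: "nat \<Rightarrow> nat \<Rightarrow> 'v protocol \<Rightarrow> bool" where
  "equality_protocol n d P \<longleftrightarrow>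
     feasibility_protocol n d P \<and>
     (\<forall>v\<in>verts P. \<exists>q r :: bool list \<Rightarrow> real.
        \<forall>x\<in>cube n. \<forall>y\<in>cube n. (x, y, v) \<in> feas P \<longleftrightarrow> q x = r y)"

end

theory Submission
  imports Defs "HOL-Library.Nat_Bijection"
begin

text \<open>
  Since \<^term>\<open>zeros f\<close> and \<^term>\<open>ones f\<close> are disjoint, they have at most \<open>2 ^ n\<close> elements together, so
  at every vertex the real numbers can be replaced by ranks with \<open>n\<close> binary digits such that the
  rank of a zero and the rank of a one never coincide. Each strict comparison then holds in one of
  \<open>n\<close> ways, according to the highest differing bit, and each of these ways is an equality of a function of
  \<open>x\<close> and a function of \<open>y\<close>. Knowing that a vertex \<open>v\<close> is feasible, with differing bit \<open>k\<close>, the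
  new protocol compares the ranks at the children of \<open>v\<close> one after the other, bit by bit, remembering \<open>k\<close> and the
  differing bits of the children already found to be infeasible, until it meets a feasible child.
  These conjunctions of equalities are again equalities.
\<close>

section \<open>Relations given by equality\<close>

text \<open>Values lie in \<open>nat\<close>, not in the reals, so that \<open>prod_encode\<close>
  can merge two equalities into one; the embedding into the reals is deferred to the assembly of the
  protocol.\<close>

definition equality_rel :: "nat \<Rightarrow> (bool list \<Rightarrow> bool list \<Rightarrow> bool) \<Rightarrow> bool" where
  "equality_rel n R \<longleftrightarrow> (\<exists>q r :: bool list \<Rightarrow> nat. \<forall>x\<in>cube n. \<forall>y\<in>cube n. R x y \<longleftrightarrow> q x = r y)"

lemma equality_relI:
  fixes q r :: "bool list \<Rightarrow> nat"
  assumes "\<And>x y. x \<in> cube n \<Longrightarrow> y \<in> cube n \<Longrightarrow> R x y \<longleftrightarrow> q x = r y"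
  shows "equality_rel n R"
  using assms unfolding equality_rel_def by blast

lemma equality_rel_const: "equality_rel n (\<lambda>x y. b)"
  by (rule equality_relI[where q = "\<lambda>_. 0" and r = "\<lambda>_. if b then 0 else 1"]) auto

lemma equality_rel_bit: "equality_rel n (\<lambda>x y. \<not> x ! i \<and> y ! i)"
  \<comment> \<open>The ranges {0, 1} and {0, 2} share only 0, so equality fixes both bits.\<close>
  by (rule equality_relI[where q = "\<lambda>x. if x ! i then 1 else 0" and r = "\<lambda>y. if y ! i then 0 else 2"])
    auto

lemma equality_rel_conj:
  assumes "equality_rel n R" "equality_rel n S"
  shows "equality_rel n (\<lambda>x y. R x y \<and> S x y)"
proof -
  obtain q r q' r' :: "bool list \<Rightarrow> nat" where
    "\<forall>x\<in>cube n. \<forall>y\<in>cube n. R x y \<longleftrightarrow> q x = r y"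
    "\<forall>x\<in>cube n. \<forall>y\<in>cube n. S x y \<longleftrightarrow> q' x = r' y"
    using assms unfolding equality_rel_def by blast
  then show ?thesis
    by (intro equality_relI[where q = "\<lambda>x. prod_encode (q x, q' x)"
          and r = "\<lambda>y. prod_encode (r y, r' y)"]) (simp add: prod_encode_eq)
qed

lemma equality_rel_all_less:
  fixes m :: nat
  assumes "\<And>i. i < m \<Longrightarrow> equality_rel n (R i)"
  shows "equality_rel n (\<lambda>x y. \<forall>i<m. R i x y)"
  using assms
proof (induction m)
  case 0
  then show ?case using equality_rel_const[of n True] by simp
next
  case (Suc m)
  have "equality_rel n (\<lambda>x y. (\<forall>i<m. R i x y) \<and> R m x y)"
    by (rule equality_rel_conj) (use Suc in auto)
  then show ?case by (simp add: less_Suc_eq all_conj_distrib imp_disjL)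
qed

section \<open>Highest differing bits\<close>

text \<open>Bit \<open>j\<close> itself is included among the agreeing bits; hence the shift to
  \<open>Suc j\<close> wherever bit \<open>j\<close> is still to be inspected.\<close>

definition agree_above :: "nat \<Rightarrow> nat \<Rightarrow> nat \<Rightarrow> bool" where
  "agree_above j a b \<longleftrightarrow> a div 2 ^ j = b div 2 ^ j"

text \<open>The two quotients differ only in their last bit, so \<open>j\<close> is the highest
  differing bit; it is 0 in \<open>a\<close> and 1 in \<open>b\<close>.\<close>

definition less_at :: "nat \<Rightarrow> nat \<Rightarrow> nat \<Rightarrow> bool" where
  "less_at j a b \<longleftrightarrow> even (a div 2 ^ j) \<and> b div 2 ^ j = Suc (a div 2 ^ j)"

lemma less_at_imp_less:
  assumes "less_at j a b"
  shows "a < b"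
proof (rule ccontr)
  assume "\<not> a < b"
  then have "b div 2 ^ j \<le> a div 2 ^ j"
    by (intro div_le_mono) simp
  then show False using assms by (simp add: less_at_def)
qed

lemma agree_above_0: "agree_above 0 a b \<longleftrightarrow> a = b"
  by (simp add: agree_above_def)

lemma agree_above_top: "a < 2 ^ n \<Longrightarrow> b < 2 ^ n \<Longrightarrow> agree_above n a b"
  by (simp add: agree_above_def)

text \<open>Dividing by \<open>2 ^ Suc j\<close> halves the quotient by \<open>2 ^ j\<close>, and
  distinct numbers with the same half are 2m and 2m + 1.\<close>

lemma agree_above_Suc:
  assumes "agree_above (Suc j) a b" "\<not> agree_above j a b"
  shows "less_at j a b \<or> less_at j b a"
proof -
  define a' b' where "a' = a div 2 ^ j" and "b' = b div 2 ^ j"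
  have "c div 2 ^ Suc j = c div 2 ^ j div 2" for c :: nat
    by (simp add: div_mult2_eq power_Suc2 del: power_Suc)
  then have "a' div 2 = b' div 2" "a' \<noteq> b'"
    using assms unfolding agree_above_def a'_def b'_def by metis+
  then have "even a' \<and> b' = Suc a' \<or> even b' \<and> a' = Suc b'"
    by presburger
  then show ?thesis by (simp add: less_at_def a'_def b'_def)
qed

lemma equality_rel_agree_above: "equality_rel n (\<lambda>x y. agree_above j (a x) (b y))"
  unfolding agree_above_def by (rule equality_relI) (rule refl)

lemma equality_rel_less_at: "equality_rel n (\<lambda>x y. less_at j (a x) (b y))"
  \<comment> \<open>The default 0 is never a successor, so it encodes failure of the parity test;
    the even case adds 1 to both sides of the equation.\<close>
  by (rule equality_relI[where q = "\<lambda>x. if even (a x div 2 ^ j) then Suc (Suc (a x div 2 ^ j)) else 0"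
        and r = "\<lambda>y. Suc (b y div 2 ^ j)"]) (auto simp: less_at_def)

lemma equality_rel_greater_at: "equality_rel n (\<lambda>x y. less_at j (b y) (a x))"
  by (rule equality_relI[where r = "\<lambda>y. if even (b y div 2 ^ j) then Suc (Suc (b y div 2 ^ j)) else 0"
        and q = "\<lambda>x. Suc (a x div 2 ^ j)"]) (auto simp: less_at_def)

text \<open>A disjunction of equalities need not be an equality. Here it is one: either order means
  that one quotient arises from the other by flipping the last bit.\<close>

lemma equality_rel_differ_at:
  "equality_rel n (\<lambda>x y. less_at j (a x) (b y) \<or> less_at j (b y) (a x))"
proof (rule equality_relI)
  fix x y
  have flip: "even m \<and> k = Suc m \<or> even k \<and> m = Suc k \<longleftrightarrow>
      (if even m then Suc m else m - 1) = k" for m k :: nat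
    by (cases "even m") (auto elim!: oddE)
  show "(less_at j (a x) (b y) \<or> less_at j (b y) (a x)) \<longleftrightarrow>
      (if even (a x div 2 ^ j) then Suc (a x div 2 ^ j) else a x div 2 ^ j - 1) = b y div 2 ^ j"
    unfolding less_at_def by (rule flip)
qed

section \<open>Ranks\<close>

lemma card_cube: "finite (cube n)" "card (cube n) = 2 ^ n"
  using finite_lists_length_eq[of "UNIV :: bool set" n] card_lists_length_eq[of "UNIV :: bool set" n]
  by (simp_all add: cube_def)

text \<open>The rank of an element is the number of elements of \<open>X \<union> Y\<close> below
  it. When \<open>q x = r y\<close>, the element \<open>y\<close> is placed below \<open>x\<close>,
  so ranks across the two sets differ and a failed strict inequality becomes a reversed one.\<close>

lemma disjoint_ranks:
  fixes q r :: "'a \<Rightarrow> real"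
  assumes fin: "finite (X \<union> Y)" and disj: "X \<inter> Y = {}"
  shows "\<exists>A B :: 'a \<Rightarrow> nat. \<forall>x\<in>X. \<forall>y\<in>Y.
    A x < card (X \<union> Y) \<and> B y < card (X \<union> Y) \<and> A x \<noteq> B y \<and> (q x < r y \<longleftrightarrow> A x < B y)"
proof -
  define SA where "SA x = {z\<in>X \<union> Y. if z \<in> X then q z < q x else r z \<le> q x}" for x
  define SB where "SB y = {z\<in>X \<union> Y. if z \<in> X then q z < r y else r z < r y}" for y
  have "card (SA x) < card (X \<union> Y) \<and> card (SB y) < card (X \<union> Y) \<and> card (SA x) \<noteq> card (SB y) \<and>
      (q x < r y \<longleftrightarrow> card (SA x) < card (SB y))" if x: "x \<in> X" and y: "y \<in> Y" for x y
  proof -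
    have ne: "y \<notin> X" using disj y by auto
    have sub: "finite (SA x)" "finite (SB y)"
      using fin by (auto simp: SA_def SB_def)
    have "SA x \<subset> X \<union> Y" "SB y \<subset> X \<union> Y"
      using x y ne by (auto simp: SA_def SB_def)
    then have bounds: "card (SA x) < card (X \<union> Y)" "card (SB y) < card (X \<union> Y)"
      by (simp_all only: psubset_card_mono[OF fin])
    show ?thesis
    proof (cases "q x < r y")
      case True
      then have "SA x \<subseteq> SB y" by (auto simp: SA_def SB_def split: if_splits)
      \<comment> \<open>No element counts itself, so \<open>x\<close> witnesses strictness of the
        inclusion; \<open>y\<close> does so in the other case.\<close>
      moreover have "x \<in> SB y - SA x" using True x by (auto simp: SA_def SB_def)
      ultimately have "card (SA x) < card (SB y)"
        using sub by (intro psubset_card_mono) auto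
      then show ?thesis using True bounds by simp
    next
      case False
      then have "SB y \<subseteq> SA x" by (auto simp: SA_def SB_def split: if_splits)
      moreover have "y \<in> SA x - SB y" using False y ne by (auto simp: SA_def SB_def)
      ultimately have "card (SB y) < card (SA x)"
        using sub by (intro psubset_card_mono) auto
      then show ?thesis using False bounds by simp
    qed
  qed
  then show ?thesis
    by (intro exI[of _ "\<lambda>x. card (SA x)"] exI[of _ "\<lambda>y. card (SB y)"] ballI)
qed

section \<open>Equality protocols from finite graphs\<close>

text \<open>Restricting to the vertices reachable from \<open>root\<close> leaves
  \<open>root\<close> as the only source, so the given graph may have spurious vertices. An
  injection into \<open>nat\<close> then renames the vertices.\<close>

lemma equality_protocol_of_graph:
  fixes W :: "'w set" and E :: "('w \<times> 'w) set" and root :: 'w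
  assumes fin: "finite W" and root: "root \<in> W" and E: "E \<subseteq> W \<times> W" and acyc: "acyclic E"
    and deg: "\<And>w. w \<in> W \<Longrightarrow> card (E `` {w}) \<le> d"
    and eq: "\<And>w. w \<in> W \<Longrightarrow> equality_rel n (R w)"
    and sink: "\<And>w. w \<in> W \<Longrightarrow> E `` {w} = {} \<Longrightarrow>
      \<exists>i<n. \<forall>x\<in>cube n. \<forall>y\<in>cube n. R w x y \<longleftrightarrow> \<not> x ! i \<and> y ! i"
    and f: "zeros f \<subseteq> cube n" "ones f \<subseteq> cube n"
    and start: "\<And>x y. x \<in> zeros f \<Longrightarrow> y \<in> ones f \<Longrightarrow> R root x y"
    and step: "\<And>w x y. w \<in> W \<Longrightarrow> E `` {w} \<noteq> {} \<Longrightarrow> x \<in> zeros f \<Longrightarrow> y \<in> ones f \<Longrightarrow> R w x y \<Longrightarrow>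
      \<exists>w'. (w, w') \<in> E \<and> R w' x y"
  shows "\<exists>Q :: nat protocol. equality_protocol n d Q \<and> solves Q f \<and> protocol_size Q \<le> card W"
proof -
  obtain g :: "'w \<Rightarrow> nat" where g: "inj_on g W"
    using fin finite_imp_inj_to_nat_seg by blast
  define V where "V = E\<^sup>* `` {root}"
  have VW: "V \<subseteq> W"
  proof
    fix w assume "w \<in> V"
    then have "(root, w) \<in> E\<^sup>*" by (simp add: V_def)
    then show "w \<in> W" by (induction) (use root E in auto)
  qed
  have rootV: "root \<in> V" by (simp add: V_def)
  have closed: "w' \<in> V" if "w \<in> V" "(w, w') \<in> E" for w w'
    using that by (auto simp: V_def intro: rtrancl_into_rtrancl)
  have inj: "g u = g w \<longleftrightarrow> u = w" if "u \<in> V" "w \<in> V" for u w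
    using g VW that by (meson inj_on_eq_iff subsetD)
  define Q :: "nat protocol" where
    "Q = \<lparr>verts = g ` V, edges = {(g u, g w) | u w. u \<in> V \<and> (u, w) \<in> E},
      feas = {(x, y, g w) | x y w. x \<in> cube n \<and> y \<in> cube n \<and> w \<in> V \<and> R w x y}\<rparr>"
  have ch: "children Q (g w) = g ` (E `` {w})" if "w \<in> V" for w
    using that inj by (auto simp: children_def Q_def)
  have feas: "(x, y, g w) \<in> feas Q \<longleftrightarrow> R w x y" if "w \<in> V" "x \<in> cube n" "y \<in> cube n" for x y w
    using that inj by (auto simp: Q_def)
  have finV: "finite V" using fin VW finite_subset by blast
  have finE: "finite E" using fin E by (meson finite_SigmaI finite_subset)
  have acycQ: "acyclic (edges Q)"
  proof -
    \<comment> \<open>For finite relations acyclicity is well-foundedness, which can be pulled back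
      along the inverse of the renaming.\<close>
    have "wf E" using finE acyc by (simp add: wf_iff_acyclic_if_finite)
    then have "wf (inv_image E (inv_into W g))" by (rule wf_inv_image)
    moreover have "edges Q \<subseteq> inv_image E (inv_into W g)"
      using E g by (auto simp: Q_def)
    ultimately show ?thesis using wf_acyclic acyclic_subset by blast
  qed
  have src: "is_source Q v \<longleftrightarrow> v = g root" for v
  proof
    assume v: "is_source Q v"
    then obtain w where w: "w \<in> V" "v = g w" by (auto simp: is_source_def Q_def)
    then have "(root, w) \<in> E\<^sup>*" by (simp add: V_def)
    then show "v = g root"
    proof (cases rule: rtranclE)
      case base
      then show ?thesis using w by simp
    next
      case (step u)
      then have "u \<in> V" by (simp add: V_def)
      then have "(g u, v) \<in> edges Q" using step w by (auto simp: Q_def)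
      then show ?thesis using v by (auto simp: is_source_def)
    qed
  next
    assume v: "v = g root"
    have "(u, g root) \<notin> edges Q" for u
    proof
      assume "(u, g root) \<in> edges Q"
      then obtain a b where ab: "a \<in> V" "(a, b) \<in> E" "g root = g b" by (auto simp: Q_def)
      then have "b = root" using inj rootV closed by metis
      \<comment> \<open>An edge from a reachable vertex into \<open>root\<close> would close a
        cycle.\<close>
      then have "(root, root) \<in> E\<^sup>+"
        using ab by (auto simp: V_def intro: rtrancl_into_trancl1)
      then show False using acyc by (auto simp: acyclic_def)
    qed
    then show "is_source Q v" using v rootV by (auto simp: is_source_def Q_def)
  qed
  then have source: "source Q = g root" by (simp add: source_def)
  have "feasibility_protocol n d Q"
    unfolding feasibility_protocol_def
  proof (intro conjI ballI allI impI)
    show "finite (verts Q)" using finV by (simp add: Q_def)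
    show "edges Q \<subseteq> verts Q \<times> verts Q" using closed by (auto simp: Q_def)
    show "acyclic (edges Q)" by (rule acycQ)
    show "feas Q \<subseteq> cube n \<times> cube n \<times> verts Q" by (auto simp: Q_def)
    show "\<exists>!v. is_source Q v" by (simp add: src)
  next
    fix v assume "v \<in> verts Q"
    then obtain w where w: "w \<in> V" "v = g w" by (auto simp: Q_def)
    have "finite (E `` {w})" using finE by (rule finite_Image)
    then have "card (children Q v) \<le> card (E `` {w})"
      using w ch by (simp add: card_image_le)
    then show "card (children Q v) \<le> d" using deg w VW by (meson le_trans subsetD)
  next
    fix l assume l: "is_sink Q l"
    then obtain w where w: "w \<in> V" "l = g w" by (auto simp: is_sink_def Q_def)
    then have "E `` {w} = {}" using l ch by (auto simp: is_sink_def)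
    then show "\<exists>i<n. \<forall>x\<in>cube n. \<forall>y\<in>cube n. (x, y, l) \<in> feas Q \<longleftrightarrow> \<not> x ! i \<and> y ! i"
      using sink[of w] w VW feas by auto
  qed
  moreover have "\<exists>q r :: bool list \<Rightarrow> real. \<forall>x\<in>cube n. \<forall>y\<in>cube n. (x, y, v) \<in> feas Q \<longleftrightarrow> q x = r y"
    if v: "v \<in> verts Q" for v
  proof -
    obtain w where w: "w \<in> V" "v = g w" using v by (auto simp: Q_def)
    then obtain q r :: "bool list \<Rightarrow> nat" where
      "\<forall>x\<in>cube n. \<forall>y\<in>cube n. R w x y \<longleftrightarrow> q x = r y"
      using eq[of w] VW unfolding equality_rel_def by blast
    then show ?thesis
      using w feas by (intro exI[of _ "\<lambda>x. real (q x)"] exI[of _ "\<lambda>y. real (r y)"]) auto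
  qed
  moreover have "solves Q f"
    unfolding solves_def
  proof (intro conjI ballI impI)
    fix x y assume xy: "x \<in> zeros f" "y \<in> ones f"
    then have cube: "x \<in> cube n" "y \<in> cube n" using f by auto
    show "(x, y, source Q) \<in> feas Q"
      using source feas[OF rootV cube] start xy by simp
    fix v assume v: "v \<in> verts Q" "children Q v \<noteq> {}" "(x, y, v) \<in> feas Q"
    then obtain w where w: "w \<in> V" "v = g w" by (auto simp: Q_def)
    then have "E `` {w} \<noteq> {}" "R w x y" using v ch feas cube by auto
    then obtain w' where w': "(w, w') \<in> E" "R w' x y"
      using step[of w x y] w VW xy by blast
    then show "\<exists>u\<in>children Q v. (x, y, u) \<in> feas Q"
      using w ch feas[OF closed[OF w(1) w'(1)] cube] by auto
  qed
  moreover have "protocol_size Q \<le> card W"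
  proof -
    have "card (g ` V) \<le> card V" using finV by (rule card_image_le)
    also have "\<dots> \<le> card W" using fin VW by (rule card_mono)
    finally show ?thesis by (simp add: protocol_size_def Q_def)
  qed
  ultimately show ?thesis unfolding equality_protocol_def by blast
qed

section \<open>The comparison protocol\<close>

locale ranked_protocol =
  fixes n d :: nat and f :: partial_fun and P :: "'v protocol"
    and cs :: "'v \<Rightarrow> 'v list" and A B :: "'v \<Rightarrow> bool list \<Rightarrow> nat"
  assumes n: "n \<ge> 1" and d: "d \<ge> 1"
    and f: "zeros f \<subseteq> cube n" "ones f \<subseteq> cube n"
    and P: "feasibility_protocol n d P" and sol: "solves P f"
    and set_cs: "v \<in> verts P \<Longrightarrow> set (cs v) = children P v"
    and length_cs: "v \<in> verts P \<Longrightarrow> length (cs v) \<le> d"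
    and ranks: "v \<in> verts P \<Longrightarrow> x \<in> zeros f \<Longrightarrow> y \<in> ones f \<Longrightarrow>
      A v x < 2 ^ n \<and> B v y < 2 ^ n \<and> A v x \<noteq> B v y \<and> ((x, y, v) \<in> feas P \<longleftrightarrow> A v x < B v y)"
begin

text \<open>At \<open>(v, k, js, b, j)\<close> the vertex \<open>v\<close> is feasible with differing bit \<open>k\<close> (the value \<open>k = n\<close> is
  reserved for the source, where no bit is needed), the first \<open>length js\<close> children of \<open>v\<close> are
  infeasible with differing bits \<open>js\<close>, and the ranks at the next child differ at bit \<open>j\<close> (if \<open>b\<close>)
  or agree above bit \<open>j\<close> (if \<open>\<not> b\<close>). If \<open>v\<close> is a sink, only the component \<open>v\<close> matters.\<close>

definition nodes :: "('v \<times> nat \<times> nat list \<times> bool \<times> nat) set" where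
  "nodes = {(v, k, js, b, j). v \<in> verts P \<and> k \<le> n \<and> set js \<subseteq> {..<n} \<and> length js < d \<and> j < n \<and>
    (cs v \<noteq> [] \<longrightarrow> length js < length (cs v))}"

text \<open>Each comparison starts at bit \<open>n - 1\<close>. At \<open>j = 0\<close> there is no
  branch for further agreement, since ranks never coincide; after the last child there is no branch
  for a further infeasible child, since some child must be feasible.\<close>

fun succs :: "'v \<times> nat \<times> nat list \<times> bool \<times> nat \<Rightarrow> ('v \<times> nat \<times> nat list \<times> bool \<times> nat) set" where
  "succs (v, k, js, b, j) =
    (if cs v = [] then {}
     else if b then
       insert (cs v ! length js, j, [], False, n - 1)
         (if Suc (length js) < length (cs v) then {(v, k, js @ [j], False, n - 1)} else {})
     else insert (v, k, js, True, j) (if j = 0 then {} else {(v, k, js, False, j - 1)}))"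

definition arcs :: "(('v \<times> nat \<times> nat list \<times> bool \<times> nat) \<times> ('v \<times> nat \<times> nat list \<times> bool \<times> nat)) set" where
  "arcs = {(w, w'). w \<in> nodes \<and> w' \<in> succs w}"

text \<open>\<open>nodes\<close> allows \<open>k = n\<close> at every vertex; testing for the source
  makes this relation empty at all other vertices, so it always implies feasibility of
  \<open>v\<close> on zeros and ones.\<close>

definition entry_rel :: "'v \<Rightarrow> nat \<Rightarrow> bool list \<Rightarrow> bool list \<Rightarrow> bool" where
  "entry_rel v k x y \<longleftrightarrow> (if k = n then v = source P else less_at k (A v x) (B v y))"

text \<open>With \<open>b\<close> set, either direction of the difference is allowed; the two
  successors split it. Sinks keep the old relation and thus their index.\<close>

fun node_rel :: "'v \<times> nat \<times> nat list \<times> bool \<times> nat \<Rightarrow> bool list \<Rightarrow> bool list \<Rightarrow> bool" where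
  "node_rel (v, k, js, b, j) x y \<longleftrightarrow>
    (if cs v = [] then (x, y, v) \<in> feas P
     else entry_rel v k x y \<and>
       (\<forall>i<length js. less_at (js ! i) (B (cs v ! i) y) (A (cs v ! i) x)) \<and>
       (let a = A (cs v ! length js) x; b' = B (cs v ! length js) y in
        if b then less_at j a b' \<or> less_at j b' a else agree_above (Suc j) a b'))"

section \<open>Closure, acyclicity and degree of the new graph\<close>

lemma child_verts:
  assumes "v \<in> verts P" "i < length (cs v)"
  shows "(v, cs v ! i) \<in> edges P" "cs v ! i \<in> verts P"
proof -
  have "cs v ! i \<in> children P v" using assms set_cs nth_mem by blast
  then show "(v, cs v ! i) \<in> edges P" by (simp add: children_def)
  then show "cs v ! i \<in> verts P" using P by (auto simp: feasibility_protocol_def)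
qed

lemma arcs_image: "w \<in> nodes \<Longrightarrow> arcs `` {w} = succs w"
  by (auto simp: arcs_def)

lemma arcs_subset: "arcs \<subseteq> nodes \<times> nodes"
proof -
  have "w' \<in> nodes" if "w \<in> nodes" "w' \<in> succs w" for w w'
  proof -
    obtain v k js b j where w: "w = (v, k, js, b, j)" by (cases w)
    then show ?thesis
      using that child_verts(2)[of v "length js"] length_cs[of v] n d
      by (auto simp: nodes_def split: if_splits)
  qed
  then show ?thesis by (auto simp: arcs_def)
qed

lemma acyclic_arcs: "acyclic arcs"
proof -
  \<comment> \<open>Lexicographic descent: moving to a child descends in \<open>P\<close>, rejecting
    a child lengthens \<open>js\<close>, and a comparison passes from weight 2j + 1 to 2j or 2j -
    1.\<close>
  let ?m = "\<lambda>(v, k, js, b, j). (v, d - length (js :: nat list), 2 * j + (if b then 0 else 1 :: nat))"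
  let ?r = "inv_image ((edges P)\<inverse> <*lex*> less_than <*lex*> less_than) ?m"
  have "finite (verts P \<times> verts P)" "edges P \<subseteq> verts P \<times> verts P" "acyclic (edges P)"
    using P by (simp_all add: feasibility_protocol_def)
  then have "finite (edges P)" "acyclic (edges P)" by (blast intro: finite_subset)+
  then have "wf ?r"
    by (intro wf_inv_image wf_lex_prod wf_less_than finite_acyclic_wf_converse)
  moreover have "arcs\<inverse> \<subseteq> ?r"
  proof -
    have "(w', w) \<in> ?r" if "w \<in> nodes" "w' \<in> succs w" for w w'
    proof -
      obtain v k js b j where w: "w = (v, k, js, b, j)" by (cases w)
      then show ?thesis
        using that child_verts(1)[of v "length js"]
        by (auto simp: nodes_def split: if_splits)
    qed
    then show ?thesis by (auto simp: arcs_def)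
  qed
  ultimately have "acyclic (arcs\<inverse>)" using wf_acyclic acyclic_subset by blast
  then show ?thesis by simp
qed

lemma card_succs: "card (succs w) \<le> 2"
proof (cases w)
  case (fields v k js b j)
  have "card (insert p (if c then {q} else {})) \<le> 2" for p q :: "'a" and c
    by (simp add: card_insert_if)
  moreover have "card (insert p (if c then {} else {q})) \<le> 2" for p q :: "'a" and c
    by (simp add: card_insert_if)
  ultimately show ?thesis unfolding fields succs.simps by simp
qed

section \<open>Equality form of the node relations\<close>

lemma sink_bit:
  assumes "v \<in> verts P" "cs v = []"
  shows "\<exists>i<n. \<forall>x\<in>cube n. \<forall>y\<in>cube n. (x, y, v) \<in> feas P \<longleftrightarrow> \<not> x ! i \<and> y ! i"
proof -
  have "is_sink P v" using assms set_cs[of v] by (simp add: is_sink_def)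
  then show ?thesis using P by (simp add: feasibility_protocol_def)
qed

lemma equality_rel_node_rel:
  assumes "w \<in> nodes"
  shows "equality_rel n (node_rel w)"
proof -
  obtain v k js b j where w: "w = (v, k, js, b, j)" by (cases w)
  show ?thesis
  proof (cases "cs v = []")
    case True
    then obtain i where "\<forall>x\<in>cube n. \<forall>y\<in>cube n. (x, y, v) \<in> feas P \<longleftrightarrow> \<not> x ! i \<and> y ! i"
      using sink_bit[of v] assms w by (auto simp: nodes_def)
    then show ?thesis
      using equality_rel_bit[of n i] True w by (simp add: equality_rel_def)
  next
    case False
    let ?u = "cs v ! length js"
    have "equality_rel n (\<lambda>x y. entry_rel v k x y)"
      unfolding entry_rel_def by (cases "k = n") (simp_all add: equality_rel_const equality_rel_less_at)
    moreover have "equality_rel n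
        (\<lambda>x y. \<forall>i<length js. less_at (js ! i) (B (cs v ! i) y) (A (cs v ! i) x))"
      by (intro equality_rel_all_less equality_rel_greater_at)
    moreover have "equality_rel n (\<lambda>x y.
        if b then less_at j (A ?u x) (B ?u y) \<or> less_at j (B ?u y) (A ?u x)
        else agree_above (Suc j) (A ?u x) (B ?u y))"
      by (cases b) (simp_all add: equality_rel_differ_at equality_rel_agree_above)
    ultimately have "equality_rel n (\<lambda>x y. entry_rel v k x y \<and>
        (\<forall>i<length js. less_at (js ! i) (B (cs v ! i) y) (A (cs v ! i) x)) \<and>
        (if b then less_at j (A ?u x) (B ?u y) \<or> less_at j (B ?u y) (A ?u x)
         else agree_above (Suc j) (A ?u x) (B ?u y)))"
      by (intro equality_rel_conj)
    moreover have "node_rel w = (\<lambda>x y. entry_rel v k x y \<and>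
        (\<forall>i<length js. less_at (js ! i) (B (cs v ! i) y) (A (cs v ! i) x)) \<and>
        (if b then less_at j (A ?u x) (B ?u y) \<or> less_at j (B ?u y) (A ?u x)
         else agree_above (Suc j) (A ?u x) (B ?u y)))"
      using False by (simp add: w Let_def fun_eq_iff)
    ultimately show ?thesis by simp
  qed
qed

section \<open>Propagation of feasibility along the arcs\<close>

lemma source_verts: "source P \<in> verts P"
proof -
  have "is_source P (source P)"
    unfolding source_def by (rule theI') (use P in \<open>simp add: feasibility_protocol_def\<close>)
  then show ?thesis by (simp add: is_source_def)
qed

lemma entry_rel_feas:
  assumes "v \<in> verts P" "x \<in> zeros f" "y \<in> ones f" "entry_rel v k x y"
  shows "(x, y, v) \<in> feas P"
proof (cases "k = n")
  case True
  then show ?thesis using assms sol by (auto simp: entry_rel_def solves_def)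
next
  case False
  then show ?thesis using assms ranks less_at_imp_less by (auto simp: entry_rel_def)
qed

text \<open>Entering a vertex costs nothing: ranks below \<open>2 ^ n\<close> trivially agree above
  bit \<open>n\<close>, which is what position \<open>n - 1\<close> with \<open>b\<close> false
  asserts.\<close>

lemma node_rel_entry:
  assumes "v \<in> verts P" "x \<in> zeros f" "y \<in> ones f" "entry_rel v k x y"
  shows "node_rel (v, k, [], False, n - 1) x y"
proof (cases "cs v = []")
  case True
  then show ?thesis using entry_rel_feas[OF assms] by simp
next
  case False
  then have "cs v ! 0 \<in> verts P" using assms child_verts(2)[of v 0] by simp
  then have "agree_above n (A (cs v ! 0) x) (B (cs v ! 0) y)"
    using ranks assms by (intro agree_above_top) auto
  then show ?thesis using assms False n by simp
qed

lemma node_rel_step: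
  assumes w: "w \<in> nodes" and ne: "succs w \<noteq> {}" and x: "x \<in> zeros f" and y: "y \<in> ones f"
    and rel: "node_rel w x y"
  shows "\<exists>w'\<in>succs w. node_rel w' x y"
proof -
  obtain v k js b j where weq: "w = (v, k, js, b, j)" by (cases w)
  have cs: "cs v \<noteq> []" using ne weq by auto
  have v: "v \<in> verts P" and js: "length js < length (cs v)" and j: "j < n"
    using w cs by (auto simp: weq nodes_def)
  define u where "u = cs v ! length js"
  have u: "u \<in> verts P" using child_verts(2)[OF v js] by (simp add: u_def)
  have entry: "entry_rel v k x y"
    and worse: "\<forall>i<length js. less_at (js ! i) (B (cs v ! i) y) (A (cs v ! i) x)"
    using rel cs by (auto simp: weq)
  show ?thesis
  proof (cases b)
    case False
    then have agree: "agree_above (Suc j) (A u x) (B u y)"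
      using rel cs by (simp add: weq u_def)
    show ?thesis
    proof (cases "agree_above j (A u x) (B u y)")
      case True
      \<comment> \<open>Agreement down to bit 0 would make the two ranks equal.\<close>
      have "j \<noteq> 0"
      proof
        assume "j = 0"
        then show False using True ranks[OF u x y] by (simp add: agree_above_0)
      qed
      then have "(v, k, js, False, j - 1) \<in> succs w" "node_rel (v, k, js, False, j - 1) x y"
        using True False cs entry worse by (simp_all add: weq u_def)
      then show ?thesis by blast
    next
      case neq: False
      have "(v, k, js, True, j) \<in> succs w" "node_rel (v, k, js, True, j) x y"
        using agree_above_Suc[OF agree neq] False cs entry worse by (simp_all add: weq u_def)
      then show ?thesis by blast
    qed
  next
    case True
    then consider "less_at j (A u x) (B u y)" | "less_at j (B u y) (A u x)"
      using rel cs by (auto simp: weq u_def Let_def)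
    then show ?thesis
    proof cases
      case 1
      \<comment> \<open>The child is feasible, and the bit just found becomes its entry bit;
        \<open>j < n\<close> keeps it apart from the reserved value.\<close>
      then have "entry_rel u j x y" using j by (simp add: entry_rel_def)
      then have "node_rel (u, j, [], False, n - 1) x y"
        by (rule node_rel_entry[OF u x y])
      moreover have "(u, j, [], False, n - 1) \<in> succs w"
        using True cs by (simp add: weq u_def)
      ultimately show ?thesis by blast
    next
      case 2
      have worse': "\<forall>i<length (js @ [j]). less_at ((js @ [j]) ! i) (B (cs v ! i) y) (A (cs v ! i) x)"
        using worse 2 by (auto simp: nth_append less_Suc_eq u_def)
      show ?thesis
      proof (cases "Suc (length js) < length (cs v)")
        case more: True
        let ?u = "cs v ! Suc (length js)"
        have "?u \<in> verts P" using child_verts(2)[OF v more] .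
        then have "agree_above n (A ?u x) (B ?u y)"
          using ranks x y by (intro agree_above_top) auto
        then have "node_rel (v, k, js @ [j], False, n - 1) x y"
          using cs entry worse' n by simp
        moreover have "(v, k, js @ [j], False, n - 1) \<in> succs w"
          using True cs more by (simp add: weq)
        ultimately show ?thesis by blast
      next
        case False
        then have len: "length (cs v) = length (js @ [j])" using js by simp
        \<comment> \<open>Every child now has its ranks in the wrong order, whereas
          \<open>solves\<close> provides a feasible one: a contradiction.\<close>
        have "children P v \<noteq> {}" using cs set_cs[OF v] by auto
        then obtain u' where u': "u' \<in> set (cs v)" "(x, y, u') \<in> feas P"
          using sol entry_rel_feas[OF v x y entry] v x y set_cs[OF v]
          unfolding solves_def by blast
        then obtain i where i: "i < length (cs v)" "u' = cs v ! i"
          by (auto simp: in_set_conv_nth)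
        then have "B u' y < A u' x" using worse' len less_at_imp_less by metis
        moreover have "u' \<in> verts P" using child_verts(2)[OF v i(1)] i(2) by simp
        ultimately show ?thesis using ranks[of u' x y] u'(2) x y by auto
      qed
    qed
  qed
qed

text \<open>The factors count the vertices, the \<open>n + 1\<close> values of \<open>k\<close>, the
  lists of length at most \<open>d - 1\<close> over \<open>n\<close> letters, and the pairs of
  \<open>b\<close> and \<open>j\<close>.\<close>

lemma finite_nodes: "finite nodes"
  and card_nodes: "card nodes \<le> card (verts P) * (Suc n * ((\<Sum>i\<le>d - 1. n ^ i) * (2 * n)))"
proof -
  let ?L = "{js :: nat list. set js \<subseteq> {..<n} \<and> length js \<le> d - 1}"
  let ?X = "verts P \<times> {..n} \<times> ?L \<times> (UNIV :: bool set) \<times> {..<n}"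
  have sub: "nodes \<subseteq> ?X" by (auto simp: nodes_def)
  have "finite (verts P)" using P by (simp add: feasibility_protocol_def)
  moreover have "finite ?L" by (simp add: finite_lists_length_le)
  ultimately have fin: "finite ?X" by auto
  have "card ?X = card (verts P) * (Suc n * ((\<Sum>i\<le>d - 1. n ^ i) * (2 * n)))"
    by (simp add: card_cartesian_product card_lists_length_le)
  then show "card nodes \<le> card (verts P) * (Suc n * ((\<Sum>i\<le>d - 1. n ^ i) * (2 * n)))"
    using card_mono[OF fin sub] by simp
  show "finite nodes" using sub fin by (rule finite_subset)
qed

lemma equality_protocol_exists:
  "\<exists>Q :: nat protocol. equality_protocol n 2 Q \<and> solves Q f \<and> protocol_size Q \<le> card nodes"
proof (rule equality_protocol_of_graph[where E = arcs and R = node_rel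
      and root = "(source P, n, [], False, n - 1)"])
  show "(source P, n, [], False, n - 1) \<in> nodes"
    using n d source_verts by (auto simp: nodes_def)
  show "node_rel (source P, n, [], False, n - 1) x y" if "x \<in> zeros f" "y \<in> ones f" for x y
    by (rule node_rel_entry) (use that source_verts in \<open>auto simp: entry_rel_def\<close>)
  show "card (arcs `` {w}) \<le> 2" if "w \<in> nodes" for w
    using card_succs that by (simp add: arcs_image)
  show "\<exists>i<n. \<forall>x\<in>cube n. \<forall>y\<in>cube n. node_rel w x y \<longleftrightarrow> \<not> x ! i \<and> y ! i"
    if w: "w \<in> nodes" "arcs `` {w} = {}" for w
  proof -
    obtain v k js b j where weq: "w = (v, k, js, b, j)" by (cases w)
    have "cs v = []" using w by (auto simp: weq arcs_image split: if_splits)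
    moreover have "v \<in> verts P" using w by (simp add: weq nodes_def)
    ultimately show ?thesis using sink_bit[of v] by (simp add: weq)
  qed
  show "\<exists>w'. (w, w') \<in> arcs \<and> node_rel w' x y"
    if "w \<in> nodes" "arcs `` {w} \<noteq> {}" "x \<in> zeros f" "y \<in> ones f" "node_rel w x y" for w x y
    using node_rel_step[of w x y] that unfolding arcs_image[OF that(1)] arcs_def by blast
qed (use finite_nodes arcs_subset acyclic_arcs equality_rel_node_rel f in auto)

end

section \<open>Final size estimate and one-bit inputs\<close>

lemma sum_powers_le:
  fixes n m :: nat
  assumes "n \<ge> 2"
  shows "(\<Sum>i\<le>m. n ^ i) \<le> n ^ Suc m"
proof (induction m)
  case 0
  then show ?case using assms by simp
next
  case (Suc m)
  have "(\<Sum>i\<le>Suc m. n ^ i) \<le> 2 * n ^ Suc m" using Suc by simp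
  also have "\<dots> \<le> n * n ^ Suc m" using assms by (intro mult_right_mono) auto
  finally show ?case by simp
qed

text \<open>Monotonicity forces index 0 to separate every zero from every one, so a single vertex,
  both source and sink, suffices.\<close>

lemma equality_protocol_one_bit:
  assumes "partial_monotone 1 f"
  shows "\<exists>Q :: nat protocol. equality_protocol 1 d Q \<and> solves Q f \<and> protocol_size Q \<le> 1"
proof -
  have "\<exists>Q :: nat protocol. equality_protocol 1 d Q \<and> solves Q f \<and> protocol_size Q \<le> card {()}"
    by (rule equality_protocol_of_graph[where E = "{}" and R = "\<lambda>_ x y. \<not> x ! 0 \<and> y ! 0"])
      (use assms equality_rel_bit in \<open>auto simp: partial_monotone_def acyclic_def\<close>)
  then show ?thesis by simp
qed

lemma equality_protocol_of_inequality_protocol: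
  fixes P :: "'v protocol"
  assumes n2: "n \<ge> 2" and d: "d \<ge> 1" and f: "partial_monotone n f"
    and P: "inequality_protocol n d P" and sol: "solves P f"
  shows "\<exists>Q :: nat protocol. equality_protocol n 2 Q \<and> solves Q f \<and>
    protocol_size Q \<le> 4 * (protocol_size P * n ^ (d + 2))"
proof -
  have feasP: "feasibility_protocol n d P" using P by (simp add: inequality_protocol_def)
  have sub: "zeros f \<union> ones f \<subseteq> cube n" and disj: "zeros f \<inter> ones f = {}"
    using f by (auto simp: partial_monotone_def)
  have finU: "finite (zeros f \<union> ones f)" using sub card_cube(1) by (rule finite_subset)
  have cardU: "card (zeros f \<union> ones f) \<le> 2 ^ n" using card_mono[OF card_cube(1) sub] card_cube(2) by simp
  have "\<exists>cs. set cs = children P v \<and> length cs \<le> d" if "v \<in> verts P" for v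
  proof -
    have "children P v \<subseteq> verts P" "finite (verts P)"
      using feasP by (auto simp: children_def feasibility_protocol_def)
    then obtain cs where "set cs = children P v" "distinct cs"
      using finite_distinct_list finite_subset by metis
    \<comment> \<open>A list without repetitions has as many entries as there are children.\<close>
    then show ?thesis
      using feasP that by (metis distinct_card feasibility_protocol_def)
  qed
  then obtain cs where cs: "set (cs v) = children P v \<and> length (cs v) \<le> d" if "v \<in> verts P" for v
    by metis
  have "\<exists>A B :: bool list \<Rightarrow> nat. \<forall>x\<in>zeros f. \<forall>y\<in>ones f.
      A x < 2 ^ n \<and> B y < 2 ^ n \<and> A x \<noteq> B y \<and> ((x, y, v) \<in> feas P \<longleftrightarrow> A x < B y)"
    if v: "v \<in> verts P" for v
  proof -
    obtain q r :: "bool list \<Rightarrow> real" where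
      qr: "\<forall>x\<in>cube n. \<forall>y\<in>cube n. (x, y, v) \<in> feas P \<longleftrightarrow> q x < r y"
      using P v unfolding inequality_protocol_def by blast
    obtain A B :: "bool list \<Rightarrow> nat" where AB: "\<forall>x\<in>zeros f. \<forall>y\<in>ones f.
        A x < card (zeros f \<union> ones f) \<and> B y < card (zeros f \<union> ones f) \<and> A x \<noteq> B y \<and>
        (q x < r y \<longleftrightarrow> A x < B y)"
      using disjoint_ranks[OF finU disj, of q r] by blast
    have "A x < 2 ^ n \<and> B y < 2 ^ n \<and> A x \<noteq> B y \<and> ((x, y, v) \<in> feas P \<longleftrightarrow> A x < B y)"
      if "x \<in> zeros f" "y \<in> ones f" for x y
    proof -
      have "x \<in> cube n" "y \<in> cube n" using sub that by auto
      then show ?thesis using qr AB[rule_format, OF that] cardU by auto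
    qed
    then show ?thesis by blast
  qed
  then obtain A B :: "'v \<Rightarrow> bool list \<Rightarrow> nat" where AB: "\<forall>x\<in>zeros f. \<forall>y\<in>ones f.
      A v x < 2 ^ n \<and> B v y < 2 ^ n \<and> A v x \<noteq> B v y \<and> ((x, y, v) \<in> feas P \<longleftrightarrow> A v x < B v y)"
    if "v \<in> verts P" for v
    by metis
  interpret ranked_protocol n d f P cs A B
    by unfold_locales (use n2 d sub feasP sol cs AB in auto)
  have "card nodes \<le> card (verts P) * (Suc n * ((\<Sum>i\<le>d - 1. n ^ i) * (2 * n)))"
    by (rule card_nodes)
  \<comment> \<open>\<open>Suc n\<close> is at most \<open>2 * n\<close> and the geometric sum at
    most \<open>n ^ d\<close>, whence the factor 4.\<close>
  also have "\<dots> \<le> card (verts P) * ((2 * n) * (n ^ d * (2 * n)))"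
    using sum_powers_le[OF n2, of "d - 1"] n2 d by (intro mult_le_mono order_refl) auto
  also have "\<dots> = 4 * (protocol_size P * n ^ (d + 2))"
    by (simp add: protocol_size_def)
  finally show ?thesis using equality_protocol_exists le_trans by blast
qed

theorem theorem1:
  "\<exists>c::real. c > 0 \<and>
     (\<forall>n d f (P :: 'v protocol).
        n \<ge> 1 \<longrightarrow> d \<ge> 1 \<longrightarrow> partial_monotone n f \<longrightarrow>
        inequality_protocol n d P \<longrightarrow> solves P f \<longrightarrow>
        (\<exists>Q :: nat protocol. equality_protocol n 2 Q \<and> solves Q f \<and>
           real (protocol_size Q) \<le> c * (real (protocol_size P) * real n ^ (d + 2)) + c))"
\<comment> \<open>The factor 4 comes from the case \<open>n \<ge> 2\<close>; as an additive term it
  covers the single vertex needed for \<open>n = 1\<close>.\<close>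
proof (intro exI[of _ 4] conjI allI impI)
  fix n d :: nat and f and P :: "'v protocol"
  assume n: "n \<ge> 1" and d: "d \<ge> 1" and f: "partial_monotone n f"
    and P: "inequality_protocol n d P" "solves P f"
  have "\<exists>Q :: nat protocol. equality_protocol n 2 Q \<and> solves Q f \<and>
      protocol_size Q \<le> 4 * (protocol_size P * n ^ (d + 2)) + 4"
  proof (cases "n = 1")
    \<comment> \<open>here the number of differing-bit lists of length less than \<open>d\<close> is \<open>d\<close> and not \<open>O(n ^ d)\<close>\<close>
    case True
    then obtain Q :: "nat protocol" where "equality_protocol n 2 Q" "solves Q f" "protocol_size Q \<le> 1"
      using equality_protocol_one_bit f by blast
    then show ?thesis by (intro exI[of _ Q]) simp
  next
    case False
    then show ?thesis
      using equality_protocol_of_inequality_protocol[OF _ d f P] n by (auto intro: trans_le_add1)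
  qed
  then obtain Q :: "nat protocol" where Q: "equality_protocol n 2 Q" "solves Q f"
    and "protocol_size Q \<le> 4 * (protocol_size P * n ^ (d + 2)) + 4"
    by blast
  then have "real (protocol_size Q) \<le> real (4 * (protocol_size P * n ^ (d + 2)) + 4)"
    by (simp only: of_nat_le_iff)
  then have "real (protocol_size Q) \<le> 4 * (real (protocol_size P) * real n ^ (d + 2)) + 4"
    by (simp only: of_nat_add of_nat_mult of_nat_power of_nat_numeral)
  then show "\<exists>Q :: nat protocol. equality_protocol n 2 Q \<and> solves Q f \<and>
      real (protocol_size Q) \<le> 4 * (real (protocol_size P) * real n ^ (d + 2)) + 4"
    using Q by blast
qed simp

end
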